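(* Let $F$ be an object of $\mathcal{RB}$, let $X,Y,Z$ be objects of $\mathcal B$, and let $\lambda_Y$ and $\lambda_Z$ be opposites of $\mu_Y$ and $\mu_Z$ respectively. For all $\alpha\in F(X)$, $\beta\in F(Y)^*$, $\gamma\in F(Y)$ and $\delta\in F(Z)^*$, we have, as a composition of maps $X\to Y\to Z$ in $\mathcal B$, $$\lambda_{ZY}(\delta,\gamma)\circ\lambda_{YX}(\beta,\alpha)=\langle\beta,\gamma\rangle\,\lambda_{ZX}(\delta,\alpha).$$
   Context: $\mathbb K$ is a field, $\mathcal B$ is a $\mathbb K$-linear category with finite-dimensional Hom spaces, and $\mathcal{RB}$ is the category of $\mathbb K$-linear functors $\mathcal B^{\mathrm{op}}\to\underline{\mathrm{Vect}}$, where $\underline{\mathrm{Vect}}$ is the category of finite-dimensional $\mathbb K$-vector spaces. For $X$ in $\mathcal B$, $X^\sharp=\operatorname{Hom}_{\mathcal B}(-,X)\in\mathcal{RB}$. For $F$ in $\mathcal{RB}$, $\mu_X:F(X)\to\operatorname{Hom}_{\mathcal{RB}}(X^\sharp,F)$ is the Yoneda isomorphism, $\mu_X(\alpha)_Z(\eta)=F(\eta)(\alpha)$ for $\eta:Z\to X$. A linear map $\lambda_X:F(X)^*\to\operatorname{Hom}_{\mathcal{RB}}(F,X^\sharp)$ is an opposite of $\mu_X$ if $\mu_X(\alpha)\circ\lambda_X(\beta)=\langle\beta,\alpha\rangle\operatorname{id}_F$ for all $\alpha\in F(X)$, $\beta\in F(X)^*$, where $\langle\beta,\alpha\rangle=\beta(\alpha)$.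 Given such $\lambda_X$, for $\beta\in F(X)^*$ and $\gamma\in F(Z)$ write $\lambda_{XZ}(\beta,\gamma)=\lambda_X(\beta)_Z(\gamma)\in\operatorname{Hom}_{\mathcal B}(Z,X)$. *)

theory Defs
  imports "HOL-Library.FuncSet" "Jordan_Normal_Form.Missing_VectorSpace"
begin

text \<open>
  Vector spaces are the \<open>module\<close> records of \<open>HOL-Algebra\<close> satisfying \<open>vectorspace K\<close>. These
  records extend rings, so they have two fields \<open>mult\<close> and \<open>one\<close> that play no role; their
  values in the spaces built below are arbitrary.

  Maps are represented extensionally (\<open>undefined\<close> outside the carrier), so that equality of
  linear maps and of natural transformations is HOL equality.
\<close>

definition lin_maps ::
    "('k, 'm) ring_scheme \<Rightarrow> ('k, 'v) module \<Rightarrow> ('k, 'w) module \<Rightarrow> ('k, 'v \<Rightarrow> 'w) module"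
  where "lin_maps K V W =
    \<lparr>carrier = LinearCombinations.module_hom K V W \<inter> extensional (carrier V),
     mult = (\<lambda>f g. \<lambda>v\<in>carrier V. \<zero>\<^bsub>W\<^esub>),
     one = (\<lambda>v\<in>carrier V. \<zero>\<^bsub>W\<^esub>),
     zero = (\<lambda>v\<in>carrier V. \<zero>\<^bsub>W\<^esub>),
     add = (\<lambda>f g. \<lambda>v\<in>carrier V. f v \<oplus>\<^bsub>W\<^esub> g v),
     smult = (\<lambda>c f. \<lambda>v\<in>carrier V. c \<odot>\<^bsub>W\<^esub> f v)\<rparr>"

definition self_module :: "('k, 'm) ring_scheme \<Rightarrow> ('k, 'k) module"
  where "self_module K =
    \<lparr>carrier = carrier K, mult = mult K, one = one K, zero = zero K, add = add K,
     smult = mult K\<rparr>"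

definition dual_space :: "('k, 'm) ring_scheme \<Rightarrow> ('k, 'v) module \<Rightarrow> ('k, 'v \<Rightarrow> 'k) module"
  where "dual_space K V = lin_maps K V (self_module K)"


text \<open>
  Hom spaces of different pairs of objects need not be disjoint, so composition is indexed by
  objects: \<open>Comp C X Y Z g f\<close> is $g \circ f$ for $f : X \to Y$ and $g : Y \to Z$.
\<close>

record ('k, 'o, 'a) lincat =
  Ob :: "'o set"
  Hom :: "'o \<Rightarrow> 'o \<Rightarrow> ('k, 'a) module"
  Ident :: "'o \<Rightarrow> 'a"
  Comp :: "'o \<Rightarrow> 'o \<Rightarrow> 'o \<Rightarrow> 'a \<Rightarrow> 'a \<Rightarrow> 'a"

locale linear_category = field K
  for K :: "('k, 'm) ring_scheme" (structure) +
  fixes C :: "('k, 'o, 'a) lincat"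
  assumes hom_vectorspace:
      "\<lbrakk>X \<in> Ob C; Y \<in> Ob C\<rbrakk> \<Longrightarrow> vectorspace K (Hom C X Y)"
    and ident_closed:
      "X \<in> Ob C \<Longrightarrow> Ident C X \<in> carrier (Hom C X X)"
    and comp_linear_left:
      "\<lbrakk>X \<in> Ob C; Y \<in> Ob C; Z \<in> Ob C; f \<in> carrier (Hom C X Y)\<rbrakk> \<Longrightarrow>
        (\<lambda>g. Comp C X Y Z g f) \<in> LinearCombinations.module_hom K (Hom C Y Z) (Hom C X Z)"
    and comp_linear_right:
      "\<lbrakk>X \<in> Ob C; Y \<in> Ob C; Z \<in> Ob C; g \<in> carrier (Hom C Y Z)\<rbrakk> \<Longrightarrow>
        (\<lambda>f. Comp C X Y Z g f) \<in> LinearCombinations.module_hom K (Hom C X Y) (Hom C X Z)"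
    and comp_ident_left:
      "\<lbrakk>X \<in> Ob C; Y \<in> Ob C; f \<in> carrier (Hom C X Y)\<rbrakk> \<Longrightarrow> Comp C X Y Y (Ident C Y) f = f"
    and comp_ident_right:
      "\<lbrakk>X \<in> Ob C; Y \<in> Ob C; f \<in> carrier (Hom C X Y)\<rbrakk> \<Longrightarrow> Comp C X X Y f (Ident C X) = f"
    and comp_assoc:
      "\<lbrakk>W \<in> Ob C; X \<in> Ob C; Y \<in> Ob C; Z \<in> Ob C; f \<in> carrier (Hom C W X);
        g \<in> carrier (Hom C X Y); h \<in> carrier (Hom C Y Z)\<rbrakk> \<Longrightarrow>
        Comp C W Y Z h (Comp C W X Y g f) = Comp C W X Z (Comp C X Y Z h g) f"

locale hom_finite_linear_category = linear_category +
  assumes hom_fin_dim: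
      "\<lbrakk>X \<in> Ob C; Y \<in> Ob C\<rbrakk> \<Longrightarrow> vectorspace.fin_dim K (Hom C X Y)"

definition op_cat :: "('k, 'o, 'a) lincat \<Rightarrow> ('k, 'o, 'a) lincat"
  where "op_cat C =
    \<lparr>Ob = Ob C, Hom = (\<lambda>X Y. Hom C Y X), Ident = Ident C,
     Comp = (\<lambda>X Y Z g f. Comp C Z Y X f g)\<rparr>"

text \<open>Finite-dimensional vector spaces whose carriers are sets over the type \<open>'v\<close>.\<close>

definition vect :: "('k, 'm) ring_scheme \<Rightarrow> ('k, ('k, 'v) module, 'v \<Rightarrow> 'v) lincat"
  where "vect K =
    \<lparr>Ob = {V. vectorspace K V \<and> vectorspace.fin_dim K V},
     Hom = lin_maps K,
     Ident = (\<lambda>V. \<lambda>v\<in>carrier V. v),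
     Comp = (\<lambda>U V W g f. compose (carrier U) g f)\<rparr>"


record ('o1, 'a1, 'o2, 'a2) cat_functor =
  fobj :: "'o1 \<Rightarrow> 'o2"
  farr :: "'o1 \<Rightarrow> 'o1 \<Rightarrow> 'a1 \<Rightarrow> 'a2"

definition linear_functor ::
    "('k, 'm) ring_scheme \<Rightarrow> ('k, 'o1, 'a1) lincat \<Rightarrow> ('k, 'o2, 'a2) lincat \<Rightarrow>
      ('o1, 'a1, 'o2, 'a2) cat_functor \<Rightarrow> bool"
  where "linear_functor K C D F \<longleftrightarrow>
    (\<forall>X\<in>Ob C. fobj F X \<in> Ob D) \<and>
    (\<forall>X\<in>Ob C. \<forall>Y\<in>Ob C.
      farr F X Y \<in> LinearCombinations.module_hom K (Hom C X Y) (Hom D (fobj F X) (fobj F Y))) \<and>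
    (\<forall>X\<in>Ob C. farr F X X (Ident C X) = Ident D (fobj F X)) \<and>
    (\<forall>X\<in>Ob C. \<forall>Y\<in>Ob C. \<forall>Z\<in>Ob C. \<forall>f\<in>carrier (Hom C X Y). \<forall>g\<in>carrier (Hom C Y Z).
      farr F X Z (Comp C X Y Z g f) =
        Comp D (fobj F X) (fobj F Y) (fobj F Z) (farr F Y Z g) (farr F X Y f))"

text \<open>
  The category $\mathcal{RB}$. Its objects are given by \<open>RB_obj\<close>; an arrow $\eta : Z \to X$ of
  \<open>B\<close> acts on \<open>F\<close> as \<open>farr F X Z \<eta>\<close>, from \<open>fobj F X\<close> to \<open>fobj F Z\<close>. The morphisms
  \<open>RB_hom\<close> are allowed between functors whose values have carriers over different types,
  because representable functors take values over the type of arrows of \<open>B\<close>.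
\<close>

type_synonym ('k, 'o, 'a, 'v) vect_functor = "('o, 'a, ('k, 'v) module, 'v \<Rightarrow> 'v) cat_functor"

definition RB_obj ::
    "('k, 'm) ring_scheme \<Rightarrow> ('k, 'o, 'a) lincat \<Rightarrow> ('k, 'o, 'a, 'v) vect_functor set"
  where "RB_obj K B = {F. linear_functor K (op_cat B) (vect K) F}"

definition nat_trans ::
    "('k, 'm) ring_scheme \<Rightarrow> ('k, 'o, 'a) lincat \<Rightarrow> ('k, 'o, 'a, 'v) vect_functor \<Rightarrow>
      ('k, 'o, 'a, 'w) vect_functor \<Rightarrow> ('o \<Rightarrow> 'v \<Rightarrow> 'w) set"
  where "nat_trans K B F G =
    {\<tau> \<in> (\<Pi>\<^sub>E X\<in>Ob B. carrier (lin_maps K (fobj F X) (fobj G X))).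
      \<forall>X\<in>Ob B. \<forall>Z\<in>Ob B. \<forall>\<eta>\<in>carrier (Hom B Z X). \<forall>v\<in>carrier (fobj F X).
        \<tau> Z (farr F X Z \<eta> v) = farr G X Z \<eta> (\<tau> X v)}"

definition RB_hom ::
    "('k, 'm) ring_scheme \<Rightarrow> ('k, 'o, 'a) lincat \<Rightarrow> ('k, 'o, 'a, 'v) vect_functor \<Rightarrow>
      ('k, 'o, 'a, 'w) vect_functor \<Rightarrow> ('k, 'o \<Rightarrow> 'v \<Rightarrow> 'w) module"
  where "RB_hom K B F G =
    \<lparr>carrier = nat_trans K B F G,
     mult = (\<lambda>\<sigma> \<tau>. \<lambda>X\<in>Ob B. \<zero>\<^bsub>lin_maps K (fobj F X) (fobj G X)\<^esub>),
     one = (\<lambda>X\<in>Ob B. \<zero>\<^bsub>lin_maps K (fobj F X) (fobj G X)\<^esub>),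
     zero = (\<lambda>X\<in>Ob B. \<zero>\<^bsub>lin_maps K (fobj F X) (fobj G X)\<^esub>),
     add = (\<lambda>\<sigma> \<tau>. \<lambda>X\<in>Ob B. \<sigma> X \<oplus>\<^bsub>lin_maps K (fobj F X) (fobj G X)\<^esub> \<tau> X),
     smult = (\<lambda>c \<tau>. \<lambda>X\<in>Ob B. c \<odot>\<^bsub>lin_maps K (fobj F X) (fobj G X)\<^esub> \<tau> X)\<rparr>"

definition RB_ident ::
    "('k, 'o, 'a) lincat \<Rightarrow> ('k, 'o, 'a, 'v) vect_functor \<Rightarrow> 'o \<Rightarrow> 'v \<Rightarrow> 'v"
  where "RB_ident B F = (\<lambda>X\<in>Ob B. \<lambda>v\<in>carrier (fobj F X). v)"

text \<open>\<open>RB_comp B F \<tau> \<sigma>\<close> is $\tau \circ \sigma$, where \<open>F\<close> is the source of \<open>\<sigma>\<close>.\<close>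

definition RB_comp ::
    "('k, 'o, 'a) lincat \<Rightarrow> ('k, 'o, 'a, 'v) vect_functor \<Rightarrow>
      ('o \<Rightarrow> 'w \<Rightarrow> 'u) \<Rightarrow> ('o \<Rightarrow> 'v \<Rightarrow> 'w) \<Rightarrow> 'o \<Rightarrow> 'v \<Rightarrow> 'u"
  where "RB_comp B F \<tau> \<sigma> = (\<lambda>X\<in>Ob B. compose (carrier (fobj F X)) (\<tau> X) (\<sigma> X))"

text \<open>The representable functor $X^\sharp = \mathrm{Hom}_{\mathcal B}(-, X)$.\<close>

definition sharp :: "('k, 'o, 'a) lincat \<Rightarrow> 'o \<Rightarrow> ('k, 'o, 'a, 'a) vect_functor"
  where "sharp B X =
    \<lparr>fobj = (\<lambda>Z. Hom B Z X),
     farr = (\<lambda>Y Z \<eta>. \<lambda>\<phi>\<in>carrier (Hom B Y X). Comp B Z Y X \<phi> \<eta>)\<rparr>"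

definition yoneda ::
    "('k, 'o, 'a) lincat \<Rightarrow> ('k, 'o, 'a, 'v) vect_functor \<Rightarrow> 'o \<Rightarrow> 'v \<Rightarrow> 'o \<Rightarrow> 'a \<Rightarrow> 'v"
  where "yoneda B F X \<alpha> = (\<lambda>Z\<in>Ob B. \<lambda>\<eta>\<in>carrier (Hom B Z X). farr F X Z \<eta> \<alpha>)"

text \<open>
  \<open>yoneda_opposite K B F X lam\<close>: \<open>lam\<close> is an opposite $\lambda_X$ of the Yoneda isomorphism
  $\mu_X$. For such \<open>lam\<close>, the arrow $\lambda_{XZ}(\beta, \gamma) : Z \to X$ is
  \<open>opposite_arrow lam Z \<beta> \<gamma>\<close>.
\<close>

definition yoneda_opposite ::
    "('k, 'm) ring_scheme \<Rightarrow> ('k, 'o, 'a) lincat \<Rightarrow> ('k, 'o, 'a, 'v) vect_functor \<Rightarrow> 'o \<Rightarrow>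
      (('v \<Rightarrow> 'k) \<Rightarrow> 'o \<Rightarrow> 'v \<Rightarrow> 'a) \<Rightarrow> bool"
  where "yoneda_opposite K B F X lam \<longleftrightarrow>
    lam \<in> LinearCombinations.module_hom K (dual_space K (fobj F X)) (RB_hom K B F (sharp B X)) \<and>
    (\<forall>\<alpha>\<in>carrier (fobj F X). \<forall>\<beta>\<in>carrier (dual_space K (fobj F X)).
      RB_comp B F (yoneda B F X \<alpha>) (lam \<beta>) = \<beta> \<alpha> \<odot>\<^bsub>RB_hom K B F F\<^esub> RB_ident B F)"

definition opposite_arrow ::
    "(('v \<Rightarrow> 'k) \<Rightarrow> 'o \<Rightarrow> 'v \<Rightarrow> 'a) \<Rightarrow> 'o \<Rightarrow> ('v \<Rightarrow> 'k) \<Rightarrow> 'v \<Rightarrow> 'a"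
  where "opposite_arrow lam Z \<beta> \<gamma> = lam \<beta> Z \<gamma>"

end

theory Submission
  imports Defs
begin

text \<open>
  Write $\eta = \lambda_{YX}(\beta, \alpha) : X \to Y$. Precomposing with $\eta$ is how the
  functor $Z^\sharp$ acts on $\eta$, and the arrow precomposed is the value of
  $\lambda_Z(\delta)_Y$ at $\gamma$. Naturality of $\lambda_Z(\delta) : F \to Z^\sharp$
  therefore turns the composite into $\lambda_Z(\delta)_X(F(\eta)(\gamma))$
  (\<open>opposite_arrow_comp\<close>). But $F(\eta)(\gamma)$ is
  $\mu_Y(\gamma)_X(\eta)$, which is the component at $X$ of $\mu_Y(\gamma) \circ \lambda_Y(\beta)$
  applied to $\alpha$; as $\lambda_Y$ is an opposite of $\mu_Y$, it equals
  $\langle \beta, \gamma \rangle \alpha$ (\<open>yoneda_opposite_apply\<close>). Linearity of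
  $\lambda_Z(\delta)_X$ pulls out the scalar.
\<close>

lemma nat_trans_component:
  assumes "\<tau> \<in> nat_trans K B F G" and "X \<in> Ob B"
  shows "\<tau> X \<in> LinearCombinations.module_hom K (fobj F X) (fobj G X)"
  using assms by (auto simp: nat_trans_def lin_maps_def PiE_iff)

lemma yoneda_opposite_nat_trans:
  assumes "yoneda_opposite K B F X lam" and "\<beta> \<in> carrier (dual_space K (fobj F X))"
  shows "lam \<beta> \<in> nat_trans K B F (sharp B X)"
  using assms by (auto simp: yoneda_opposite_def RB_hom_def module_hom_def)

lemma opposite_arrow_closed:
  assumes "yoneda_opposite K B F X lam" and "\<beta> \<in> carrier (dual_space K (fobj F X))"
    and "Z \<in> Ob B" and "\<gamma> \<in> carrier (fobj F Z)"
  shows "opposite_arrow lam Z \<beta> \<gamma> \<in> carrier (Hom B Z X)"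
  using nat_trans_component[OF yoneda_opposite_nat_trans[OF assms(1,2)] assms(3)] assms(4)
  by (auto simp: module_hom_def sharp_def opposite_arrow_def)

text \<open>
  The equation of morphisms $\mu_X(\alpha) \circ \lambda_X(\beta) = \langle\beta,\alpha\rangle\,
  \mathrm{id}_F$, read on a single element of $F(Z)$.
\<close>

lemma yoneda_opposite_apply:
  assumes opp: "yoneda_opposite K B F X lam"
    and \<beta>: "\<beta> \<in> carrier (dual_space K (fobj F X))"
    and \<alpha>: "\<alpha> \<in> carrier (fobj F X)"
    and Z: "Z \<in> Ob B" and \<gamma>: "\<gamma> \<in> carrier (fobj F Z)"
  shows "farr F X Z (opposite_arrow lam Z \<beta> \<gamma>) \<alpha> = \<beta> \<alpha> \<odot>\<^bsub>fobj F Z\<^esub> \<gamma>"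
proof -
  have "farr F X Z (opposite_arrow lam Z \<beta> \<gamma>) \<alpha> =
      RB_comp B F (yoneda B F X \<alpha>) (lam \<beta>) Z \<gamma>"
    using opposite_arrow_closed[OF opp \<beta> Z \<gamma>] Z \<gamma>
    by (simp add: RB_comp_def yoneda_def compose_def opposite_arrow_def)
  also have "\<dots> = (\<beta> \<alpha> \<odot>\<^bsub>RB_hom K B F F\<^esub> RB_ident B F) Z \<gamma>"
    using opp \<alpha> \<beta> by (simp add: yoneda_opposite_def)
  also have "\<dots> = \<beta> \<alpha> \<odot>\<^bsub>fobj F Z\<^esub> \<gamma>"
    using Z \<gamma> by (simp add: RB_hom_def lin_maps_def RB_ident_def)
  finally show ?thesis .
qed

text \<open>Naturality of $\lambda_Z(\delta) : F \to Z^\sharp$, as a rule for composing with an arrow.\<close>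

lemma opposite_arrow_comp:
  assumes opp: "yoneda_opposite K B F Z lam"
    and \<delta>: "\<delta> \<in> carrier (dual_space K (fobj F Z))"
    and X: "X \<in> Ob B" and Y: "Y \<in> Ob B"
    and \<eta>: "\<eta> \<in> carrier (Hom B X Y)" and \<gamma>: "\<gamma> \<in> carrier (fobj F Y)"
  shows "Comp B X Y Z (opposite_arrow lam Y \<delta> \<gamma>) \<eta> =
    opposite_arrow lam X \<delta> (farr F Y X \<eta> \<gamma>)"
proof -
  have "lam \<delta> X (farr F Y X \<eta> \<gamma>) = farr (sharp B Z) Y X \<eta> (lam \<delta> Y \<gamma>)"
    using yoneda_opposite_nat_trans[OF opp \<delta>] X Y \<eta> \<gamma> by (simp add: nat_trans_def)
  then show ?thesis
    using opposite_arrow_closed[OF opp \<delta> Y \<gamma>] by (simp add: sharp_def opposite_arrow_def)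
qed

theorem proposition2p4:
  fixes K :: "('k, 'm) ring_scheme"
    and B :: "('k, 'o, 'a) lincat"
    and F :: "('k, 'o, 'a, 'v) vect_functor"
    and X Y Z :: 'o
    and lamY lamZ :: "('v \<Rightarrow> 'k) \<Rightarrow> 'o \<Rightarrow> 'v \<Rightarrow> 'a"
    and \<alpha> \<gamma> :: 'v
    and \<beta> \<delta> :: "'v \<Rightarrow> 'k"
  assumes "hom_finite_linear_category K B"
    and "F \<in> RB_obj K B"
    and "X \<in> Ob B" and "Y \<in> Ob B" and "Z \<in> Ob B"
    and "yoneda_opposite K B F Y lamY"
    and "yoneda_opposite K B F Z lamZ"
    and "\<alpha> \<in> carrier (fobj F X)"
    and "\<beta> \<in> carrier (dual_space K (fobj F Y))"
    and "\<gamma> \<in> carrier (fobj F Y)"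
    and "\<delta> \<in> carrier (dual_space K (fobj F Z))"
  shows "Comp B X Y Z (opposite_arrow lamZ Y \<delta> \<gamma>) (opposite_arrow lamY X \<beta> \<alpha>) =
    \<beta> \<gamma> \<odot>\<^bsub>Hom B X Z\<^esub> opposite_arrow lamZ X \<delta> \<alpha>"
proof -
  let ?\<eta> = "opposite_arrow lamY X \<beta> \<alpha>"
  have "?\<eta> \<in> carrier (Hom B X Y)"
    using assms by (intro opposite_arrow_closed)
  then have "Comp B X Y Z (opposite_arrow lamZ Y \<delta> \<gamma>) ?\<eta> =
      opposite_arrow lamZ X \<delta> (farr F Y X ?\<eta> \<gamma>)"
    using assms by (intro opposite_arrow_comp)
  also have "farr F Y X ?\<eta> \<gamma> = \<beta> \<gamma> \<odot>\<^bsub>fobj F X\<^esub> \<alpha>"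
    using assms by (intro yoneda_opposite_apply)
  also have "opposite_arrow lamZ X \<delta> (\<beta> \<gamma> \<odot>\<^bsub>fobj F X\<^esub> \<alpha>) =
      \<beta> \<gamma> \<odot>\<^bsub>Hom B X Z\<^esub> opposite_arrow lamZ X \<delta> \<alpha>"
  proof -
    have "lamZ \<delta> X \<in> LinearCombinations.module_hom K (fobj F X) (Hom B X Z)"
      using nat_trans_component[OF yoneda_opposite_nat_trans, of K B F Z lamZ \<delta> X] assms
      by (simp add: sharp_def)
    moreover have "\<beta> \<gamma> \<in> carrier K"
      using assms(9,10)
      by (auto simp: dual_space_def lin_maps_def self_module_def module_hom_def)
    ultimately show ?thesis
      using assms(8) by (simp add: module_hom_def opposite_arrow_def)
  qed
  finally show ?thesis .
qed

end
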